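(* Let $q\in\mathbb{N}^+$ and let $B_1,\ldots,B_q\subseteq \mathbb{N}^+$ be nonempty sets such that $B:=B_1\cup \cdots \cup B_q$ is infinite. Suppose that each infinite $B_i$ has increasing enumeration $(b_{i,n}:n\in\mathbb{N}^+)$ satisfying $\liminf_{n\to\infty} b_{i,n+1}/b_{i,n}>1$. Then for each $\alpha \in [0,1]$ there exists a set $A\subseteq \mathbb{N}^+$ such that $\mathsf{d}(A)=0$ and $\mathsf{d}(A+B)=\alpha$.
   Context: $\mathbb{N}^+=\{1,2,\ldots\}$. For $S\subseteq \mathbb{N}^+$, the asymptotic density is $\mathsf{d}(S):=\lim_{n\to\infty} |S\cap[1,n]|/n$, provided the limit exists; "$\mathsf{d}(S)=\alpha$" means that the limit exists and equals $\alpha$. The sumset is $A+B:=\{x+y: x\in A, y\in B\}$. *)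

theory Defs
  imports "HOL-Analysis.Analysis" "HOL-Library.Set_Algebras"
begin

definition has_density :: "nat set \<Rightarrow> real \<Rightarrow> bool" where
  "has_density S \<alpha> \<longleftrightarrow>
     (\<lambda>n. real (card (S \<inter> {1..n})) / real n) \<longlonglongrightarrow> \<alpha>"

end

theory Submission
  imports Defs "HOL-Library.Discrete_Functions" "HOL-Real_Asymp.Real_Asymp"
begin

text \<open>
  Only two properties of $B$ matter: it is infinite, and $|B \cap (x, y]| \le C (1 + \ln (y/x))$.
  Cut the integers into blocks $(z, z + L]$ with $L \approx z / g$, where $g = g(z)$ is the integer
  square root of $|B \cap [1, z]|$, and let $F$ be the part of $B$ below $z / g^2$. By the
  logarithmic bound $F$ contains most of $B \cap [1, z]$. As long as a fraction $1/g$ of the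
  block is uncovered, averaging over the translates of $F$ finds one covering at least $|F| / g$
  new points; hence $O(L / g)$ translates cover the proportion $\alpha$ of the block almost
  exactly. The union $A$ of the chosen translation points has density $0$. The sums $a + b$ with
  $b$ beyond the truncation point of the block of $a$ are negligible, since $B$ has only
  $O(\ln g + \ln (N / z))$ such elements up to $N$.
\<close>

section \<open>Logarithmic counting bounds for lacunary sets\<close>

text \<open>Beyond some index the ratios of consecutive elements exceed a fixed \<open>r\<close> >
  1, so the elements grow geometrically and at most 1 + ln (y / x) / ln r of them fit into (x, y].
  The finitely many earlier elements are absorbed into the constant.\<close>

lemma lacunary_count:
  fixes S :: "nat set"
  assumes "infinite S"
    and "liminf (\<lambda>n. ereal (real (enumerate S (Suc n)) / real (enumerate S n))) > 1"
  shows "\<exists>C\<ge>0. \<forall>x y. 0 < x \<longrightarrow> x \<le> y \<longrightarrow>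
           real (card (S \<inter> {x<..y})) \<le> C * (1 + ln (real y / real x))"
proof -
  define b where "b = enumerate S"
  obtain r where r: "1 < ereal r"
      "ereal r < liminf (\<lambda>n. ereal (real (b (Suc n)) / real (b n)))"
    using ereal_dense2[OF assms(2)] unfolding b_def by blast
  have r1: "1 < r" using r(1) by simp
  obtain n0 where n0: "\<And>n. n \<ge> n0 \<Longrightarrow> r < real (b (Suc n)) / real (b n)"
    using less_LiminfD[OF r(2)] unfolding eventually_sequentially by auto
  \<comment> \<open>Division by zero yields 0, so a quotient exceeding \<open>r\<close> > 1 forces a
    nonzero denominator.\<close>
  have pos: "b n > 0" if "n \<ge> n0" for n
    using n0[OF that] r1 by (cases "b n = 0") auto
  have step: "r * b n \<le> b (Suc n)" if "n \<ge> n0" for n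
    using n0[OF that] pos[OF that] by (simp add: field_simps)
  have geom: "r ^ k * b n \<le> b (n + k)" if "n \<ge> n0" for n k
  proof (induction k)
    case (Suc k)
    have "r ^ Suc k * b n = r * (r ^ k * b n)" by simp
    also have "\<dots> \<le> r * b (n + k)"
      using Suc.IH r1 by (intro mult_left_mono) auto
    also have "\<dots> \<le> b (Suc (n + k))" using that by (intro step) auto
    finally show ?case by simp
  qed simp
  have lnr: "ln r > 0" using r1 by simp
  \<comment> \<open>\<open>n0\<close> pays for the early elements, 1 for the fencepost in
    \<open>s - p + 1\<close>, and \<open>1 / ln r\<close> for the geometric growth.\<close>
  define C where "C = real n0 + 1 + 1 / ln r"
  have "C \<ge> 0" using lnr by (simp add: C_def)
  moreover have "real (card (S \<inter> {x<..y})) \<le> C * (1 + ln (real y / real x))"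
    if xy: "0 < x" "x \<le> y" for x y
  proof -
    define T where "T = {n. n0 \<le> n \<and> x < b n \<and> b n \<le> y}"
    have inj: "strict_mono b"
      unfolding b_def using assms(1) by (rule strict_mono_enumerate)
    have "T \<subseteq> {..y}"
    proof
      fix n assume "n \<in> T"
      moreover have "n \<le> b n" using inj by (rule strict_mono_imp_increasing)
      ultimately show "n \<in> {..y}" by (auto simp: T_def)
    qed
    then have fT: "finite T" using finite_subset by blast
    have ln0: "ln (real y / real x) \<ge> 0" using xy by simp
    have cT: "real (card T) \<le> 1 + ln (real y / real x) / ln r"
    proof (cases "T = {}")
      case True
      then show ?thesis using ln0 lnr by simp
    next
      case False
      define p s where "p = Min T" and "s = Max T"
      have ps: "p \<in> T" "s \<in> T" "p \<le> s" using False fT by (auto simp: p_def s_def)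
      have "T \<subseteq> {p..s}" using fT by (auto simp: p_def s_def)
      then have "card T \<le> card {p..s}" by (intro card_mono) auto
      then have c1: "card T \<le> s - p + 1" using ps by simp
      \<comment> \<open>From the first to the last index in \<open>T\<close> the enumeration grows
        by a factor at least \<open>r ^ (s - p)\<close>, yet it stays inside (x, y].\<close>
      have "r ^ (s - p) * x \<le> r ^ (s - p) * b p"
        using ps r1 by (intro mult_left_mono) (auto simp: T_def)
      also have "\<dots> \<le> b s" using geom[of p "s - p"] ps by (auto simp: T_def)
      also have "\<dots> \<le> y" using ps by (auto simp: T_def)
      finally have "r ^ (s - p) \<le> real y / real x" using xy by (simp add: field_simps)
      then have "ln (r ^ (s - p)) \<le> ln (real y / real x)" using r1 xy by simp
      then have "real (s - p) \<le> ln (real y / real x) / ln r"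
        using lnr r1 by (simp add: ln_realpow field_simps)
      then show ?thesis using c1 by linarith
    qed
    have "S \<inter> {x<..y} \<subseteq> b ` {..<n0} \<union> b ` T"
    proof
      fix z assume z: "z \<in> S \<inter> {x<..y}"
      obtain n where "b n = z" using enumerate_Ex[of S z] z assms(1) unfolding b_def by auto
      then show "z \<in> b ` {..<n0} \<union> b ` T"
        using z by (cases "n < n0") (auto simp: T_def)
    qed
    then have "card (S \<inter> {x<..y}) \<le> card (b ` {..<n0} \<union> b ` T)"
      using fT by (intro card_mono) auto
    also have "\<dots> \<le> card (b ` {..<n0}) + card (b ` T)" by (rule card_Un_le)
    also have "\<dots> \<le> n0 + card T"
      using card_image_le[of "{..<n0}" b] card_image_le[OF fT, of b] by simp
    finally have "real (card (S \<inter> {x<..y})) \<le> real n0 + 1 + ln (real y / real x) / ln r"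
      using cT by linarith
    also have "\<dots> \<le> C * (1 + ln (real y / real x))"
      using ln0 lnr by (simp add: C_def algebra_simps)
    finally show ?thesis .
  qed
  ultimately show ?thesis by blast
qed

lemma lacunary_Union_count:
  fixes B :: "'i \<Rightarrow> nat set"
  assumes "finite I"
    and "\<And>i. i \<in> I \<Longrightarrow> infinite (B i) \<Longrightarrow>
           liminf (\<lambda>n. ereal (real (enumerate (B i) (Suc n)) / real (enumerate (B i) n))) > 1"
  shows "\<exists>C\<ge>0. \<forall>x y. 0 < x \<longrightarrow> x \<le> y \<longrightarrow>
           real (card ((\<Union>i\<in>I. B i) \<inter> {x<..y})) \<le> C * (1 + ln (real y / real x))"
proof -
  have "\<exists>C\<ge>0. \<forall>x y. 0 < x \<longrightarrow> x \<le> y \<longrightarrow>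
          real (card (B i \<inter> {x<..y})) \<le> C * (1 + ln (real y / real x))" if "i \<in> I" for i
  proof (cases "finite (B i)")
    case True
    \<comment> \<open>A finite set can use its own cardinality as constant, since the logarithm is
      nonnegative here.\<close>
    have "real (card (B i \<inter> {x<..y})) \<le> real (card (B i)) * (1 + ln (real y / real x))"
      if "0 < x" "x \<le> y" for x y
    proof -
      have "real (card (B i \<inter> {x<..y})) \<le> real (card (B i)) * 1"
        using True by (simp add: card_mono)
      also have "\<dots> \<le> real (card (B i)) * (1 + ln (real y / real x))"
        using that by (intro mult_left_mono) auto
      finally show ?thesis .
    qed
    then show ?thesis by (intro exI[of _ "real (card (B i))"]) auto
  next
    case False
    then show ?thesis using lacunary_count assms(2) that by blast
  qed
  then obtain C where C: "\<And>i. i \<in> I \<Longrightarrow> C i \<ge> 0"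
      "\<And>i x y. i \<in> I \<Longrightarrow> 0 < x \<Longrightarrow> x \<le> y \<Longrightarrow>
         real (card (B i \<inter> {x<..y})) \<le> C i * (1 + ln (real y / real x))"
    by metis
  have "real (card ((\<Union>i\<in>I. B i) \<inter> {x<..y})) \<le> sum C I * (1 + ln (real y / real x))"
    if "0 < x" "x \<le> y" for x y
  proof -
    have "(\<Union>i\<in>I. B i) \<inter> {x<..y} = (\<Union>i\<in>I. B i \<inter> {x<..y})" by auto
    then have "real (card ((\<Union>i\<in>I. B i) \<inter> {x<..y})) \<le> real (\<Sum>i\<in>I. card (B i \<inter> {x<..y}))"
      using card_UN_le[OF assms(1), of "\<lambda>i. B i \<inter> {x<..y}"] by (simp only: of_nat_le_iff)
    also have "\<dots> \<le> (\<Sum>i\<in>I. C i * (1 + ln (real y / real x)))"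
      unfolding of_nat_sum using C(2) that by (intro sum_mono) auto
    finally show ?thesis by (simp add: sum_distrib_right)
  qed
  moreover have "sum C I \<ge> 0" using C(1) by (simp add: sum_nonneg)
  ultimately show ?thesis by blast
qed

section \<open>Greedy covering of a block by translates\<close>

text \<open>Induction on \<open>k\<close>, adding one translate at a time. While fewer than
  \<open>t\<close> points are covered, averaging over all translation points in the block yields one
  that covers at least \<open>c\<close> new points; once \<open>t\<close> is reached, nothing more
  is added. A single translate adds at most \<open>card F\<close> points, which bounds the
  overshoot.\<close>

lemma greedy_cover:
  fixes x L M :: nat and F :: "nat set" and t c :: real
  assumes F: "F \<subseteq> {1..M}" and t: "t \<ge> 0" and c: "c > 0" and L: "L > 0"
    and gain: "c * real L \<le> real (card F) * (real L - real M - t)"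
  shows "\<exists>A\<subseteq>{x<..x+L}. card A \<le> k \<and>
           real (card ((A + F) \<inter> {x<..x+L})) \<le> t + real (card F) \<and>
           min t (real k * c) \<le> real (card ((A + F) \<inter> {x<..x+L}))"
proof (induction k)
  case 0
  have "({}::nat set) + F = {}" by (simp add: set_plus_def)
  then show ?case using t by (intro exI[of _ "{}"]) auto
next
  case (Suc k)
  let ?I = "{x<..x+L}"
  have fF: "finite F" using F finite_subset by blast
  obtain A where A: "A \<subseteq> ?I" "card A \<le> k"
      "real (card ((A + F) \<inter> ?I)) \<le> t + real (card F)"
      "min t (real k * c) \<le> real (card ((A + F) \<inter> ?I))"
    using Suc.IH by blast
  show ?case
  proof (cases "real (card ((A + F) \<inter> ?I)) \<ge> t")
    case True
    then show ?thesis using A by (intro exI[of _ A]) auto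
  next
    case False
    define U where "U = ?I - (A + F)"
    have "card U + card ((A + F) \<inter> ?I) = card (U \<union> ((A + F) \<inter> ?I))"
      by (rule card_Un_disjoint[symmetric]) (auto simp: U_def)
    also have "U \<union> ((A + F) \<inter> ?I) = ?I" by (auto simp: U_def)
    finally have cU: "real (card U) \<ge> real L - t" using False by simp
    \<comment> \<open>The first \<open>M\<close> points are discarded so that u - f, with f at most
      \<open>M\<close>, still lies in the block and is a legitimate translation point.\<close>
    have U': "real (card (U - {x<..x+M})) \<ge> real L - real M - t"
      using diff_card_le_card_Diff[of "{x<..x+M}" U] cU by simp
    have hit: "card (U - {x<..x+M}) \<le> card {a \<in> ?I. a + f \<in> U}" if "f \<in> F" for f
    proof (rule card_inj_on_le[of "\<lambda>u. u - f"])
      have f: "1 \<le> f" "f \<le> M" using that F by auto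
      show "inj_on (\<lambda>u. u - f) (U - {x<..x+M})"
        using f by (auto simp: inj_on_def U_def)
      show "(\<lambda>u. u - f) ` (U - {x<..x+M}) \<subseteq> {a \<in> ?I. a + f \<in> U}"
        using f by (auto simp: U_def)
    qed simp
    \<comment> \<open>Double counting of the pairs (a, f) for which a + f is uncovered.\<close>
    have swap: "(\<Sum>a\<in>?I. card {f \<in> F. a + f \<in> U}) = (\<Sum>f\<in>F. card {a \<in> ?I. a + f \<in> U})"
    proof -
      have "(\<Sum>a\<in>?I. card {f \<in> F. a + f \<in> U}) = (\<Sum>a\<in>?I. \<Sum>f\<in>{f \<in> F. a + f \<in> U}. 1)"
        by simp
      also have "\<dots> = (\<Sum>f\<in>F. \<Sum>a\<in>{a \<in> ?I. a + f \<in> U}. 1)"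
        by (rule sum.swap_restrict) (use fF in auto)
      finally show ?thesis by simp
    qed
    have "\<exists>a\<in>?I. c \<le> real (card {f \<in> F. a + f \<in> U})"
    proof (rule ccontr)
      \<comment> \<open>If every translate gained less than \<open>c\<close>, the number of pairs
        would be below \<open>c * real L\<close>, contradicting \<open>gain\<close>.\<close>
      assume "\<not> ?thesis"
      then have "(\<Sum>a\<in>?I. real (card {f \<in> F. a + f \<in> U})) < (\<Sum>a\<in>?I. c)"
        using L by (intro sum_strict_mono) (auto simp: not_le)
      then have "real (\<Sum>a\<in>?I. card {f \<in> F. a + f \<in> U}) < c * real L"
        by (simp add: mult.commute)
      moreover have "real (card F) * (real L - real M - t)
          \<le> real (card F) * real (card (U - {x<..x+M}))"
        using U' by (intro mult_left_mono) auto
      moreover have "card F * card (U - {x<..x+M}) \<le> (\<Sum>f\<in>F. card {a \<in> ?I. a + f \<in> U})"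
        using sum_mono[of F "\<lambda>_. card (U - {x<..x+M})" "\<lambda>f. card {a \<in> ?I. a + f \<in> U}"] hit by simp
      then have "real (card F) * real (card (U - {x<..x+M}))
          \<le> real (\<Sum>a\<in>?I. card {f \<in> F. a + f \<in> U})"
        by (simp only: swap of_nat_le_iff flip: of_nat_mult)
      ultimately show False using gain by linarith
    qed
    then obtain a where a: "a \<in> ?I" "c \<le> real (card {f \<in> F. a + f \<in> U})" by blast
    let ?N = "(\<lambda>f. a + f) ` {f \<in> F. a + f \<in> U}"
    have "insert a A + F = (A + F) \<union> (\<lambda>f. a + f) ` F" by (auto simp: set_plus_def)
    then have eq: "(insert a A + F) \<inter> ?I = ((A + F) \<inter> ?I) \<union> ?N"
      by (auto simp: U_def)
    have "card ?N = card {f \<in> F. a + f \<in> U}" by (intro card_image) (auto simp: inj_on_def)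
    moreover have "card (((A + F) \<inter> ?I) \<union> ?N) = card ((A + F) \<inter> ?I) + card ?N"
      by (rule card_Un_disjoint) (use fF in \<open>auto simp: U_def\<close>)
    ultimately have new: "card ((insert a A + F) \<inter> ?I)
        = card ((A + F) \<inter> ?I) + card {f \<in> F. a + f \<in> U}"
      unfolding eq by simp
    have "card {f \<in> F. a + f \<in> U} \<le> card F" using fF by (intro card_mono) auto
    then have "real (card ((insert a A + F) \<inter> ?I)) \<le> t + real (card F)"
      using new False by linarith
    moreover have "min t (real (Suc k) * c) \<le> real (card ((insert a A + F) \<inter> ?I))"
      using new a(2) A(4) False by (simp add: algebra_simps min_def split: if_splits)
    moreover have "card (insert a A) \<le> Suc k"
      using A(2) card_insert_le_m1[of "Suc k" A a] by simp
    ultimately show ?thesis using a(1) A(1) by (intro exI[of _ "insert a A"]) auto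
  qed
qed

section \<open>From block averages to asymptotic density\<close>

text \<open>From some index \<open>J\<close> on, each \<open>u j\<close> differs from
  \<open>l\<close> times the increment of \<open>y\<close> by at most e / 2 times that increment.
  These errors telescope, and the fixed error accumulated up to \<open>J\<close> disappears after
  division by \<open>y k\<close>.\<close>

lemma stolz_cesaro:
  fixes u y :: "nat \<Rightarrow> real"
  assumes mono: "strict_mono y" and top: "filterlim y at_top sequentially"
    and lim: "(\<lambda>j. u j / (y (Suc j) - y j)) \<longlonglongrightarrow> l"
  shows "(\<lambda>k. (\<Sum>j<k. u j) / y k) \<longlonglongrightarrow> l"
proof (rule LIMSEQ_I)
  fix e :: real assume e: "e > 0"
  have d: "y (Suc j) - y j > 0" for j using mono by (simp add: strict_mono_Suc_iff)
  obtain J where J: "\<And>j. j \<ge> J \<Longrightarrow> \<bar>u j / (y (Suc j) - y j) - l\<bar> < e / 2"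
    using LIMSEQ_D[OF lim, of "e/2"] e by auto
  have err: "\<bar>u j - l * (y (Suc j) - y j)\<bar> \<le> e / 2 * (y (Suc j) - y j)" if "j \<ge> J" for j
  proof -
    have "u j - l * (y (Suc j) - y j) = (u j / (y (Suc j) - y j) - l) * (y (Suc j) - y j)"
      using d[of j] by (simp add: field_simps)
    then have "\<bar>u j - l * (y (Suc j) - y j)\<bar>
        = \<bar>u j / (y (Suc j) - y j) - l\<bar> * (y (Suc j) - y j)"
      using d[of j] by (simp add: abs_mult)
    also have "\<dots> \<le> e / 2 * (y (Suc j) - y j)"
      using J[OF that] d[of j] by (intro mult_right_mono) auto
    finally show ?thesis .
  qed
  define c where "c = \<bar>(\<Sum>j<J. u j) - l * y J\<bar>"
  have bound: "\<bar>(\<Sum>j<k. u j) - l * y k\<bar> \<le> c + e / 2 * (y k - y J)" if "k \<ge> J" for k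
    using that
  proof (induction rule: dec_induct)
    case base
    then show ?case by (simp add: c_def)
  next
    case (step k)
    have "(\<Sum>j<Suc k. u j) - l * y (Suc k)
        = ((\<Sum>j<k. u j) - l * y k) + (u k - l * (y (Suc k) - y k))"
      by (simp add: algebra_simps)
    then have "\<bar>(\<Sum>j<Suc k. u j) - l * y (Suc k)\<bar>
        \<le> \<bar>(\<Sum>j<k. u j) - l * y k\<bar> + \<bar>u k - l * (y (Suc k) - y k)\<bar>"
      by linarith
    also have "\<dots> \<le> c + e / 2 * (y k - y J) + e / 2 * (y (Suc k) - y k)"
      using step by (intro add_mono err)
    also have "\<dots> = c + e / 2 * (y (Suc k) - y J)" by (simp add: field_simps)
    finally show ?case .
  qed
  \<comment> \<open>The second threshold is the point past which the right-hand side of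
    \<open>bound\<close> is below \<open>e * y k\<close>; the 1 keeps \<open>y k\<close> positive
    for the division.\<close>
  have "\<forall>\<^sub>F k in sequentially. y k > max 1 (2 * (c - e / 2 * y J) / e)"
    using top unfolding filterlim_at_top_dense by blast
  then obtain K where K: "\<And>k. k \<ge> K \<Longrightarrow> y k > max 1 (2 * (c - e / 2 * y J) / e)"
    unfolding eventually_sequentially by auto
  show "\<exists>no. \<forall>n\<ge>no. norm ((\<Sum>j<n. u j) / y n - l) < e"
  proof (intro exI allI impI)
    fix k assume k: "k \<ge> max J K"
    have yk: "y k > 1" "2 * (c - e / 2 * y J) / e < y k" using K[of k] k by auto
    then have "c - e / 2 * y J < e / 2 * y k" using e by (simp add: field_simps)
    then have "\<bar>(\<Sum>j<k. u j) - l * y k\<bar> < e * y k"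
      using bound[of k] k by (simp add: field_simps)
    moreover have "(\<Sum>j<k. u j) / y k - l = ((\<Sum>j<k. u j) - l * y k) / y k"
      using yk by (simp add: field_simps)
    ultimately show "norm ((\<Sum>j<k. u j) / y k - l) < e"
      using yk by (simp add: abs_divide pos_divide_less_eq)
  qed
qed

text \<open>For n between consecutive terms of \<open>x\<close>, monotonicity of \<open>f\<close>
  squeezes f(n) / n between the values of \<open>f\<close> at these terms, each divided by the
  opposite term. Exchanging the denominators costs only a factor tending to 1.\<close>

lemma tendsto_ratio_of_subseq:
  fixes f :: "nat \<Rightarrow> nat" and x :: "nat \<Rightarrow> nat"
  assumes f: "mono f" and x: "strict_mono x"
    and ratio: "(\<lambda>k. real (x (Suc k)) / real (x k)) \<longlonglongrightarrow> 1"
    and lim: "(\<lambda>k. real (f (x k)) / real (x k)) \<longlonglongrightarrow> l"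
  shows "(\<lambda>n. real (f n) / real n) \<longlonglongrightarrow> l"
proof -
  \<comment> \<open>For n at least \<open>x 0\<close>, \<open>K n\<close> is the index with
    \<open>x (K n) \<le> n < x (Suc (K n))\<close>.\<close>
  define K where "K n = (LEAST k. n < x (Suc k))" for n
  have inc: "k \<le> x k" for k using x by (rule strict_mono_imp_increasing)
  have K1: "n < x (Suc (K n))" for n
    unfolding K_def by (rule LeastI[of _ n]) (use inc[of "Suc n"] in linarith)
  have K2: "x (K n) \<le> n" if "n \<ge> x 0" for n
  proof (cases "K n")
    case 0
    then show ?thesis using that by simp
  next
    case (Suc k)
    then have "\<not> n < x (Suc k)" using not_less_Least[of k "\<lambda>k. n < x (Suc k)"] unfolding K_def by simp
    then show ?thesis using Suc by simp
  qed
  have Ktop: "filterlim K at_top sequentially"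
    unfolding filterlim_at_top
  proof
    fix k
    have "k \<le> K n" if "n \<ge> x k" for n
    proof (rule ccontr)
      assume "\<not> k \<le> K n"
      then have "x (Suc (K n)) \<le> x k" using x by (simp add: strict_mono_less_eq)
      then show False using K1[of n] that by simp
    qed
    then show "\<forall>\<^sub>F n in sequentially. k \<le> K n" unfolding eventually_sequentially by blast
  qed
  have xpos: "x (Suc k) > 0" for k using inc[of "Suc k"] by simp
  have lo: "(\<lambda>k. real (f (x k)) / real (x k) / (real (x (Suc k)) / real (x k))) \<longlonglongrightarrow> l / 1"
    by (intro tendsto_divide lim ratio) simp
  have hi: "(\<lambda>k. real (f (x (Suc k))) / real (x (Suc k)) * (real (x (Suc k)) / real (x k)))
              \<longlonglongrightarrow> l * 1"
    by (intro tendsto_mult ratio LIMSEQ_Suc[OF lim])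
  \<comment> \<open>Starting at \<open>x 1\<close> makes \<open>K n\<close> nonzero, hence
    \<open>x (K n)\<close> positive; \<open>x 0\<close> itself may be 0.\<close>
  have ev: "\<forall>\<^sub>F n in sequentially. n \<ge> x 1" by (rule eventually_ge_at_top)
  have pos: "x (K n) > 0 \<and> x (K n) \<le> n" if "n \<ge> x 1" for n
  proof -
    have "K n \<noteq> 0" using K1[of n] that by (metis One_nat_def not_le)
    moreover have "x 0 \<le> x 1" using x by (simp add: strict_mono_less_eq)
    ultimately show ?thesis using K2[of n] that inc[of "K n"] by auto
  qed
  show ?thesis
  proof (rule tendsto_sandwich)
    show "(\<lambda>n. real (f (x (K n))) / real (x (K n)) / (real (x (Suc (K n))) / real (x (K n)))) \<longlonglongrightarrow> l"
      using filterlim_compose[OF lo Ktop] by simp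
    show "(\<lambda>n. real (f (x (Suc (K n)))) / real (x (Suc (K n))) * (real (x (Suc (K n))) / real (x (K n))))
            \<longlonglongrightarrow> l"
      using filterlim_compose[OF hi Ktop] by simp
    show "\<forall>\<^sub>F n in sequentially. real (f (x (K n))) / real (x (K n)) / (real (x (Suc (K n))) / real (x (K n)))
            \<le> real (f n) / real n"
      using ev
    proof eventually_elim
      case (elim n)
      have "real (f (x (K n))) / real (x (Suc (K n))) \<le> real (f n) / real n"
        using pos[OF elim] K1[of n] monoD[OF f, of "x (K n)" n] by (intro frac_le) auto
      then show ?case using pos[OF elim] by simp
    qed
    show "\<forall>\<^sub>F n in sequentially. real (f n) / real n
        \<le> real (f (x (Suc (K n)))) / real (x (Suc (K n))) * (real (x (Suc (K n))) / real (x (K n)))"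
      using ev
    proof eventually_elim
      case (elim n)
      have "real (f n) / real n \<le> real (f (x (Suc (K n)))) / real (x (K n))"
        using pos[OF elim] K1[of n] monoD[OF f, of n "x (Suc (K n))"] by (intro frac_le) auto
      then show ?case using xpos[of "K n"] by simp
    qed
  qed
qed

text \<open>Stolz-Cesaro with the block lengths as increments gives the limit along the block ends,
  and the counting function is monotone, so the limit extends to all n. The elements up to
  \<open>x 0\<close> contribute only a constant.\<close>

lemma has_density_of_blocks:
  fixes S :: "nat set" and x :: "nat \<Rightarrow> nat"
  assumes x: "strict_mono x"
    and ratio: "(\<lambda>k. real (x (Suc k)) / real (x k)) \<longlonglongrightarrow> 1"
    and lim: "(\<lambda>j. real (card (S \<inter> {x j<..x (Suc j)})) / (real (x (Suc j)) - real (x j))) \<longlonglongrightarrow> l"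
  shows "has_density S l"
proof -
  define s where "s = card (S \<inter> {1..x 0})"
  have count: "card (S \<inter> {1..x k}) = s + (\<Sum>j<k. card (S \<inter> {x j<..x (Suc j)}))" for k
  proof (induction k)
    case (Suc k)
    have "x k \<le> x (Suc k)" using x by (simp add: strict_mono_less_eq)
    then have "S \<inter> {1..x (Suc k)} = (S \<inter> {1..x k}) \<union> (S \<inter> {x k<..x (Suc k)})" by auto
    moreover have "card ((S \<inter> {1..x k}) \<union> (S \<inter> {x k<..x (Suc k)}))
        = card (S \<inter> {1..x k}) + card (S \<inter> {x k<..x (Suc k)})"
      by (rule card_Un_disjoint) auto
    ultimately show ?case using Suc by simp
  qed (simp add: s_def)
  have y: "strict_mono (\<lambda>k. real (x k))" using x by (simp add: strict_mono_def)
  have top: "filterlim (\<lambda>k. real (x k)) at_top sequentially"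
    by (rule filterlim_compose[OF filterlim_real_sequentially filterlim_subseq[OF x]])
  have "(\<lambda>k. (\<Sum>j<k. real (card (S \<inter> {x j<..x (Suc j)}))) / real (x k)) \<longlonglongrightarrow> l"
    by (rule stolz_cesaro[OF y top lim])
  moreover have "(\<lambda>k. real (s) / real (x k)) \<longlonglongrightarrow> 0"
    by (rule real_tendsto_divide_at_top[OF tendsto_const top])
  ultimately have "(\<lambda>k. real (s) / real (x k)
      + (\<Sum>j<k. real (card (S \<inter> {x j<..x (Suc j)}))) / real (x k)) \<longlonglongrightarrow> 0 + l"
    by (intro tendsto_add)
  then have "(\<lambda>k. real (card (S \<inter> {1..x k})) / real (x k)) \<longlonglongrightarrow> l"
    unfolding count by (simp add: add_divide_distrib)
  moreover have "mono (\<lambda>n. card (S \<inter> {1..n}))"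
    by (intro monoI card_mono) auto
  ultimately show ?thesis
    unfolding has_density_def using tendsto_ratio_of_subseq[OF _ x ratio] by blast
qed

section \<open>Construction of a single block\<close>

lemma real_div_ge_half:
  fixes z d :: nat
  assumes "0 < d" "d \<le> z"
  shows "real z \<le> 2 * real d * real (z div d)"
proof -
  have "z < d * (z div d) + d"
    using assms(1) by (metis div_mult_mod_eq mod_less_divisor mult.commute nat_add_left_cancel_less)
  moreover have "1 \<le> z div d" using assms by (simp add: div_greater_zero_iff Suc_le_eq)
  then have "d * 1 \<le> d * (z div d)" by (rule mult_le_mono2)
  ultimately have "z \<le> 2 * (d * (z div d))" by linarith
  then have "real z \<le> real (2 * (d * (z div d)))" by (simp only: of_nat_le_iff)
  then show ?thesis by simp
qed

lemma counting_sqrt_at_top: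
  fixes B :: "nat set"
  assumes "B \<subseteq> {1..}" "infinite B"
  shows "filterlim (\<lambda>z. floor_sqrt (card (B \<inter> {1..z}))) at_top sequentially"
  unfolding filterlim_at_top
proof
  fix k
  obtain T where T: "finite T" "card T = k\<^sup>2" "T \<subseteq> B"
    using infinite_arbitrarily_large[OF assms(2)] by metis
  have "k \<le> floor_sqrt (card (B \<inter> {1..z}))" if "z \<ge> Max (insert 0 T)" for z
  proof -
    have "T \<subseteq> B \<inter> {1..z}" using T assms(1) that by auto
    then have "k\<^sup>2 \<le> card (B \<inter> {1..z})" using T(2) by (metis card_mono finite_Int finite_atLeastAtMost)
    then show ?thesis by (simp add: le_floor_sqrtI)
  qed
  then show "\<forall>\<^sub>F z in sequentially. k \<le> floor_sqrt (card (B \<inter> {1..z}))"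
    unfolding eventually_sequentially by blast
qed

text \<open>For late \<open>z\<close> the truncated set still has at least g^2 / 2 elements, so each
  greedy translate can be made to gain at least g / 2 points and O(L / g) translates suffice. Having
  this for every late \<open>z\<close> allows the next block to start wherever the previous one
  ends.\<close>

lemma exists_block:
  fixes B :: "nat set" and C \<alpha> :: real
  assumes B: "B \<subseteq> {1..}" and infB: "infinite B"
    and cnt: "\<And>x y. 0 < x \<Longrightarrow> x \<le> y \<Longrightarrow>
           real (card (B \<inter> {x<..y})) \<le> C * (1 + ln (real y / real x))"
    and C: "C \<ge> 0" and \<alpha>: "0 \<le> \<alpha>" "\<alpha> \<le> 1"
    and g_def: "g = (\<lambda>z. floor_sqrt (card (B \<inter> {1..z})))"
  shows "\<forall>\<^sub>F z in sequentially. \<exists>L M A. g z \<ge> 3 \<and> L \<ge> 1 \<and> M \<ge> 1 \<and> real L \<le> real z / real (g z) \<and>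
    real z \<le> 2 * (real (g z))\<^sup>2 * real M \<and> real M \<le> 2 * real L / real (g z) \<and>
    A \<subseteq> {z<..z+L} \<and> real (card A) \<le> 4 * real L / real (g z) \<and>
    min \<alpha> (1 - 3 / real (g z)) * real L \<le> real (card ((A + (B \<inter> {1..M})) \<inter> {z<..z+L})) \<and>
    real (card ((A + (B \<inter> {1..M})) \<inter> {z<..z+L})) \<le> min \<alpha> (1 - 3 / real (g z)) * real L + real M"
proof -
  have top: "filterlim g at_top sequentially"
    unfolding g_def by (rule counting_sqrt_at_top[OF B infB])
  \<comment> \<open>The truncation removes at most C (1 + ln (2 g^2)) elements of \<open>B\<close>,
    because z / M is at most 2 g^2. Eventually this is less than half of g^2.\<close>
  have "(\<lambda>n::nat. (1 + ln (2 * (real n)\<^sup>2)) / (real n)\<^sup>2) \<longlonglongrightarrow> 0" by real_asymp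
  from tendsto_mult_right_zero[OF this, of C]
  have "\<forall>\<^sub>F n in sequentially. C * ((1 + ln (2 * (real n)\<^sup>2)) / (real n)\<^sup>2) < 1 / 2"
    by (rule order_tendstoD) simp
  then have "\<forall>\<^sub>F z in sequentially. C * ((1 + ln (2 * (real (g z))\<^sup>2)) / (real (g z))\<^sup>2) < 1 / 2"
    using top by (rule eventually_compose_filterlim)
  moreover have "\<forall>\<^sub>F z in sequentially. g z \<ge> 3"
    using top by (simp add: filterlim_at_top)
  ultimately show ?thesis
  proof eventually_elim
    case (elim z)
    define n where "n = g z"
    have n3: "n \<ge> 3" using elim by (simp add: n_def)
    have Cn: "C * (1 + ln (2 * (real n)\<^sup>2)) < (real n)\<^sup>2 / 2"
      using elim(1) n3 by (simp add: n_def[symmetric] field_simps)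
    have "card (B \<inter> {1..z}) \<le> card {1..z}" by (intro card_mono) auto
    then have hz: "card (B \<inter> {1..z}) \<le> z" by simp
    have nh: "n\<^sup>2 \<le> card (B \<inter> {1..z})" by (simp add: n_def g_def)
    then have nz: "n\<^sup>2 \<le> z" using hz by simp
    then have nz': "n \<le> z" using le_square[of n] unfolding power2_eq_square by (rule order.trans[rotated])
    define L M where "L = z div n" and "M = z div n\<^sup>2"
    have L1: "L \<ge> 1" using nz' n3 by (simp add: L_def div_greater_zero_iff Suc_le_eq)
    have M1: "M \<ge> 1" using nz n3 by (simp add: M_def div_greater_zero_iff Suc_le_eq)
    have Lz: "real L \<le> real z / real n" unfolding L_def by (rule of_nat_div_le_of_nat)
    have zM: "real z \<le> 2 * (real n)\<^sup>2 * real M"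
      using real_div_ge_half[of "n\<^sup>2" z] nz n3 by (simp add: M_def)
    \<comment> \<open>Division by \<open>n\<^sup>2\<close> is division by \<open>n\<close> performed
      twice, so \<open>M\<close> is \<open>L div n\<close>.\<close>
    have "n * M \<le> L"
      by (simp add: L_def M_def power2_eq_square div_mult2_eq)
    then have nM: "real n * real M \<le> real L" by (metis of_nat_le_iff of_nat_mult)
    have M_le: "real M \<le> 2 * real L / real n" using nM n3 by (simp add: field_simps)
    define F where "F = B \<inter> {1..M}"
    define m where "m = card F"
    have "card F \<le> card {1..M}" unfolding F_def by (intro card_mono) auto
    then have mM: "m \<le> M" by (simp add: m_def)
    have Mz: "M \<le> z" unfolding M_def by (rule div_le_dividend)
    have "B \<inter> {1..z} \<subseteq> F \<union> (B \<inter> {M<..z})" by (auto simp: F_def)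
    then have "card (B \<inter> {1..z}) \<le> card (F \<union> (B \<inter> {M<..z}))"
      by (intro card_mono) (auto simp: F_def)
    also have "\<dots> \<le> m + card (B \<inter> {M<..z})" unfolding m_def by (rule card_Un_le)
    finally have "real (n\<^sup>2) \<le> real m + real (card (B \<inter> {M<..z}))" using nh by linarith
    moreover have "real (card (B \<inter> {M<..z})) \<le> C * (1 + ln (real z / real M))"
      using M1 Mz by (intro cnt) auto
    moreover have "C * (1 + ln (real z / real M)) \<le> C * (1 + ln (2 * (real n)\<^sup>2))"
    proof (intro mult_left_mono add_left_mono C)
      have "real z / real M \<le> 2 * (real n)\<^sup>2" using zM M1 by (simp add: field_simps)
      then show "ln (real z / real M) \<le> ln (2 * (real n)\<^sup>2)"
        using M1 Mz by (intro ln_mono) auto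
    qed
    ultimately have mn: "real m \<ge> (real n)\<^sup>2 / 2" using Cn by simp
    have m0: "m > 0" using mn n3 by (intro Nat.gr0I) auto
    \<comment> \<open>The cap 1 - 3/n leaves at least 3 L / n points uncovered. Discarding
      \<open>M\<close>, at most 2 L / n, of them still leaves L / n, which is what the averaging
      needs for a gain of \<open>c\<close> = m / n.\<close>
    define t where "t = min \<alpha> (1 - 3 / real n) * real L"
    have t0: "t \<ge> 0" using \<alpha> n3 by (simp add: t_def)
    have t1: "t \<le> (1 - 3 / real n) * real L" unfolding t_def by (intro mult_right_mono) auto
    have tL: "t \<le> real L"
    proof -
      have "(1 - 3 / real n) * real L \<le> 1 * real L" by (intro mult_right_mono) auto
      then show ?thesis using t1 by simp
    qed
    define c where "c = real m / real n"
    have c0: "c > 0" using m0 n3 by (simp add: c_def)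
    have "t \<le> real L - 3 * (real L / real n)" using t1 by (simp add: algebra_simps)
    moreover have "real M \<le> 2 * (real L / real n)" using M_le by simp
    ultimately have "real L / real n \<le> real L - real M - t" by linarith
    then have "real m * (real L / real n) \<le> real m * (real L - real M - t)"
      by (intro mult_left_mono) auto
    then have gain: "c * real L \<le> real (card F) * (real L - real M - t)"
      by (simp add: c_def m_def)
    \<comment> \<open>Enough steps of gain \<open>c\<close> to reach \<open>t\<close>. The extra 1
      from rounding up is absorbed using \<open>real L / c \<ge> 1\<close>, and \<open>c\<close> is
      at least n / 2.\<close>
    define k where "k = nat \<lceil>t / c\<rceil>"
    have k: "t \<le> real k * c"
      using c0 real_nat_ceiling_ge[of "t / c"] by (simp add: k_def pos_divide_le_eq)
    obtain A where A: "A \<subseteq> {z<..z+L}" "card A \<le> k"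
        "real (card ((A + F) \<inter> {z<..z+L})) \<le> t + real m"
        "min t (real k * c) \<le> real (card ((A + F) \<inter> {z<..z+L}))"
      using greedy_cover[of F M t c L z k] t0 c0 L1 gain by (auto simp: F_def m_def)
    have "real k \<le> t / c + 1"
      using t0 c0 unfolding k_def by (simp add: of_nat_ceiling)
    also have "\<dots> \<le> real L / c + 1" using tL c0 by (simp add: divide_right_mono)
    also have "\<dots> \<le> 2 * (real L / c)"
    proof -
      have "real m \<le> real M" using mM by simp
      also have "\<dots> \<le> real n * real M" using n3 mult_right_mono[of 1 "real n" "real M"] by simp
      also have "\<dots> \<le> real L" by (rule nM)
      also have "\<dots> \<le> real n * real L" using n3 mult_right_mono[of 1 "real n" "real L"] by simp
      finally have "real L / c \<ge> 1" using m0 by (simp add: c_def field_simps)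
      then show ?thesis by simp
    qed
    also have "\<dots> \<le> 4 * real L / real n"
    proof -
      have "real n / 2 \<le> c" using mn n3 by (simp add: c_def field_simps power2_eq_square)
      then have "real L / c \<le> real L / (real n / 2)" using n3 by (intro divide_left_mono) auto
      then show ?thesis by simp
    qed
    finally have cA: "real (card A) \<le> 4 * real L / real n" using A(2) by linarith
    have "t \<le> real (card ((A + F) \<inter> {z<..z+L}))" using A(4) k by simp
    moreover have "real (card ((A + F) \<inter> {z<..z+L})) \<le> t + real M" using A(3) mM by simp
    ultimately show ?case
      unfolding n_def[symmetric]
      by (intro exI[of _ L] exI[of _ M] exI[of _ A])
        (use n3 L1 M1 Lz zM M_le A(1) cA in \<open>simp add: t_def F_def\<close>)
  qed
qed

section \<open>Assembling the blocks\<close>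

theorem sumset_density:
  fixes B :: "nat set" and C \<alpha> :: real
  assumes B: "B \<subseteq> {1..}" and infB: "infinite B"
    and cnt: "\<And>x y. 0 < x \<Longrightarrow> x \<le> y \<Longrightarrow>
           real (card (B \<inter> {x<..y})) \<le> C * (1 + ln (real y / real x))"
    and C: "C \<ge> 0" and \<alpha>: "0 \<le> \<alpha>" "\<alpha> \<le> 1"
  shows "\<exists>A\<subseteq>{1..}. has_density A 0 \<and> has_density (A + B) \<alpha>"
proof -
  define g where "g = (\<lambda>z. floor_sqrt (card (B \<inter> {1..z})))"
  define Q where "Q z L M A \<longleftrightarrow> g z \<ge> 3 \<and> L \<ge> 1 \<and> M \<ge> 1 \<and> real L \<le> real z / real (g z) \<and>
    real z \<le> 2 * (real (g z))\<^sup>2 * real M \<and> real M \<le> 2 * real L / real (g z) \<and>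
    A \<subseteq> {z<..z+L} \<and> real (card A) \<le> 4 * real L / real (g z) \<and>
    min \<alpha> (1 - 3 / real (g z)) * real L \<le> real (card ((A + (B \<inter> {1..M})) \<inter> {z<..z+L})) \<and>
    real (card ((A + (B \<inter> {1..M})) \<inter> {z<..z+L})) \<le> min \<alpha> (1 - 3 / real (g z)) * real L + real M"
    for z L M A
  have "\<forall>\<^sub>F z in sequentially. \<exists>L M A. Q z L M A"
    unfolding Q_def by (rule exists_block[OF B infB cnt C \<alpha> g_def])
  then obtain X0 where "\<forall>z\<ge>X0. \<exists>L M A. Q z L M A" unfolding eventually_sequentially by blast
  then obtain L M A where Q: "\<And>z. z \<ge> X0 \<Longrightarrow> Q z (L z) (M z) (A z)" by metis
  \<comment> \<open>The ten conjuncts of \<open>Q\<close> in order: (1) to (3) are the lower bounds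
    on \<open>g\<close>, \<open>L\<close>, \<open>M\<close>; (4) to (6) compare sizes; (7) and (8)
    locate and count \<open>A\<close>; (9) and (10) bound the covered part.\<close>
  note block = Q[unfolded Q_def, THEN conjunct1]
    Q[unfolded Q_def, THEN conjunct2, THEN conjunct1]
    Q[unfolded Q_def, THEN conjunct2, THEN conjunct2, THEN conjunct1]
    Q[unfolded Q_def, THEN conjunct2, THEN conjunct2, THEN conjunct2, THEN conjunct1]
    Q[unfolded Q_def, THEN conjunct2, THEN conjunct2, THEN conjunct2, THEN conjunct2, THEN conjunct1]
    Q[unfolded Q_def, THEN conjunct2, THEN conjunct2, THEN conjunct2, THEN conjunct2, THEN conjunct2, THEN conjunct1]
    Q[unfolded Q_def, THEN conjunct2, THEN conjunct2, THEN conjunct2, THEN conjunct2, THEN conjunct2, THEN conjunct2, THEN conjunct1]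
    Q[unfolded Q_def, THEN conjunct2, THEN conjunct2, THEN conjunct2, THEN conjunct2, THEN conjunct2, THEN conjunct2, THEN conjunct2, THEN conjunct1]
    Q[unfolded Q_def, THEN conjunct2, THEN conjunct2, THEN conjunct2, THEN conjunct2, THEN conjunct2, THEN conjunct2, THEN conjunct2, THEN conjunct2, THEN conjunct1]
    Q[unfolded Q_def, THEN conjunct2, THEN conjunct2, THEN conjunct2, THEN conjunct2, THEN conjunct2, THEN conjunct2, THEN conjunct2, THEN conjunct2, THEN conjunct2]
  \<comment> \<open>Each block begins where the previous one ends. The start \<open>X0 + 1\<close>
    keeps all endpoints positive and in the range where \<open>Q\<close> is available.\<close>
  define x where "x = rec_nat (X0 + 1) (\<lambda>_ z. z + L z)"
  have x0: "x 0 = X0 + 1" and xS: "x (Suc j) = x j + L (x j)" for j by (simp_all add: x_def)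
  have xX: "x j \<ge> X0 + 1" for j by (induction j) (auto simp: x0 xS)
  have xX0: "x j \<ge> X0" and xpos: "x j > 0" for j using xX[of j] by auto
  have xmono: "strict_mono x"
    unfolding strict_mono_Suc_iff using block(2)[OF xX0] by (simp add: xS Suc_le_eq)
  have xtop: "filterlim x at_top sequentially" by (rule filterlim_subseq[OF xmono])
  have rxtop: "filterlim (\<lambda>k. real (x k)) at_top sequentially"
    by (rule filterlim_compose[OF filterlim_real_sequentially xtop])
  have rxmono: "strict_mono (\<lambda>k. real (x k))" using xmono by (simp add: strict_mono_def)
  define \<gamma> where "\<gamma> j = real (g (x j))" for j
  have \<gamma>3: "\<gamma> j \<ge> 3" for j using block(1)[OF xX0, of j] by (simp add: \<gamma>_def)
  have gtop: "filterlim (\<lambda>j. g (x j)) at_top sequentially"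
    using filterlim_compose[OF counting_sqrt_at_top[OF B infB] xtop] by (simp add: g_def)
  have \<gamma>lim: "(\<lambda>j. f (\<gamma> j)) \<longlonglongrightarrow> l" if "(\<lambda>n. f (real n)) \<longlonglongrightarrow> l" for f :: "real \<Rightarrow> real" and l
    unfolding \<gamma>_def by (rule filterlim_compose[OF that gtop])
  define \<Lambda> where "\<Lambda> j = real (L (x j))" for j
  have \<Lambda>0: "\<Lambda> j > 0" for j using block(2)[OF xX0, of j] by (simp add: \<Lambda>_def)
  have \<Lambda>x: "real (x (Suc j)) - real (x j) = \<Lambda> j" for j by (simp add: xS \<Lambda>_def)
  have ratio: "(\<lambda>k. real (x (Suc k)) / real (x k)) \<longlonglongrightarrow> 1"
  proof -
    have "(\<lambda>k. \<Lambda> k / real (x k)) \<longlonglongrightarrow> 0"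
    proof (rule tendsto_sandwich[OF _ _ tendsto_const])
      show "(\<lambda>k. 1 / \<gamma> k) \<longlonglongrightarrow> 0" by (rule \<gamma>lim) real_asymp
      show "\<forall>\<^sub>F k in sequentially. 0 \<le> \<Lambda> k / real (x k)" using \<Lambda>0 by (simp add: less_imp_le)
      show "\<forall>\<^sub>F k in sequentially. \<Lambda> k / real (x k) \<le> 1 / \<gamma> k"
      proof (intro always_eventually allI)
        fix k
        show "\<Lambda> k / real (x k) \<le> 1 / \<gamma> k"
          using block(4)[OF xX0, of k] xpos[of k] \<gamma>3[of k] by (simp add: \<Lambda>_def \<gamma>_def field_simps)
      qed
    qed
    then have "(\<lambda>k. 1 + \<Lambda> k / real (x k)) \<longlonglongrightarrow> 1 + 0" by (intro tendsto_add tendsto_const)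
    moreover have "1 + \<Lambda> k / real (x k) = real (x (Suc k)) / real (x k)" for k
      using \<Lambda>x[of k] xpos[of k] by (simp add: field_simps)
    ultimately show ?thesis by simp
  qed
  define I where "I j = {x j<..x (Suc j)}" for j
  have I_unique: "i = j" if "n \<in> I i" "n \<in> I j" for n i j
  proof (rule ccontr)
    assume "i \<noteq> j"
    then have "Suc i \<le> j \<or> Suc j \<le> i" by auto
    then have "x (Suc i) \<le> x j \<or> x (Suc j) \<le> x i" using xmono by (simp add: strict_mono_less_eq)
    then show False using that by (auto simp: I_def)
  qed
  define \<A> where "\<A> = (\<Union>j. A (x j))"
  \<comment> \<open>\<open>P j\<close> collects the sums that the greedy construction controls:
    translation point and sum in the same block, summand from \<open>B\<close> below the truncation.
    \<open>D\<close> is their union, and \<open>E\<close> is everything else in the sumset.\<close>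
  define P where "P j = (A (x j) + (B \<inter> {1..M (x j)})) \<inter> I j" for j
  define D where "D = (\<Union>j. P j)"
  define E where "E = (\<A> + B) - D"
  have AI: "A (x j) \<subseteq> I j" for j using block(7)[OF xX0, of j] by (simp add: I_def xS)
  have \<A>I: "\<A> \<inter> I j = A (x j)" for j
  proof (intro equalityI subsetI)
    fix n assume "n \<in> \<A> \<inter> I j"
    then obtain i where i: "n \<in> A (x i)" "n \<in> I j" by (auto simp: \<A>_def)
    then have "i = j" using AI[of i] by (blast intro: I_unique)
    then show "n \<in> A (x j)" using i by simp
  qed (use AI[of j] in \<open>auto simp: \<A>_def\<close>)
  have DI: "D \<inter> I j = P j" for j
  proof (intro equalityI subsetI)
    fix n assume "n \<in> D \<inter> I j"
    then obtain i where i: "n \<in> P i" "n \<in> I j" by (auto simp: D_def)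
    then have "i = j" by (intro I_unique[of n]) (auto simp: P_def)
    then show "n \<in> P j" using i by simp
  qed (auto simp: D_def P_def)
  \<comment> \<open>Needed twice: for the overshoot of the greedy cover in \<open>D\<close>, and for
    the sums in \<open>E\<close> that spill over the end of a block.\<close>
  have M0: "(\<lambda>j. real (M (x j)) / \<Lambda> j) \<longlonglongrightarrow> 0"
  proof (rule tendsto_sandwich[OF _ _ tendsto_const])
    show "(\<lambda>k. 2 / \<gamma> k) \<longlonglongrightarrow> 0" by (rule \<gamma>lim) real_asymp
    show "\<forall>\<^sub>F k in sequentially. 0 \<le> real (M (x k)) / \<Lambda> k" using \<Lambda>0 by (simp add: less_imp_le)
    show "\<forall>\<^sub>F k in sequentially. real (M (x k)) / \<Lambda> k \<le> 2 / \<gamma> k"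
    proof (intro always_eventually allI)
      fix k
      show "real (M (x k)) / \<Lambda> k \<le> 2 / \<gamma> k"
        using block(6)[OF xX0, of k] \<Lambda>0[of k] \<gamma>3[of k] by (simp add: \<Lambda>_def \<gamma>_def field_simps)
    qed
  qed

  \<comment> \<open>Density of the set of translation points\<close>
  have "has_density \<A> 0"
  proof (rule has_density_of_blocks[OF xmono ratio])
    have "(\<lambda>j. real (card (A (x j))) / \<Lambda> j) \<longlonglongrightarrow> 0"
    proof (rule tendsto_sandwich[OF _ _ tendsto_const])
      show "(\<lambda>k. 4 / \<gamma> k) \<longlonglongrightarrow> 0" by (rule \<gamma>lim) real_asymp
      show "\<forall>\<^sub>F k in sequentially. 0 \<le> real (card (A (x k))) / \<Lambda> k"
        using \<Lambda>0 by (simp add: less_imp_le)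
      show "\<forall>\<^sub>F k in sequentially. real (card (A (x k))) / \<Lambda> k \<le> 4 / \<gamma> k"
      proof (intro always_eventually allI)
        fix k
        show "real (card (A (x k))) / \<Lambda> k \<le> 4 / \<gamma> k"
          using block(8)[OF xX0, of k] \<Lambda>0[of k] \<gamma>3[of k] by (simp add: \<Lambda>_def \<gamma>_def field_simps)
      qed
    qed
    then show "(\<lambda>j. real (card (\<A> \<inter> {x j<..x (Suc j)})) / (real (x (Suc j)) - real (x j))) \<longlonglongrightarrow> 0"
      unfolding I_def[symmetric] \<A>I \<Lambda>x .
  qed

  \<comment> \<open>Density of the controlled sums\<close>
  moreover have "has_density D \<alpha>"
  proof (rule has_density_of_blocks[OF xmono ratio])
    \<comment> \<open>The cap tends to 1, so the target proportions converge to \<alpha> even when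
      \<alpha> = 1.\<close>
    have "(\<lambda>n. 1 - 3 / real n) \<longlonglongrightarrow> 1" by real_asymp
    then have "(\<lambda>j. min \<alpha> (1 - 3 / \<gamma> j)) \<longlonglongrightarrow> min \<alpha> 1"
      by (intro tendsto_min tendsto_const \<gamma>lim)
    then have lim: "(\<lambda>j. min \<alpha> (1 - 3 / \<gamma> j)) \<longlonglongrightarrow> \<alpha>" using \<alpha> by (simp add: min_def)
    have "(\<lambda>j. real (card (P j)) / \<Lambda> j) \<longlonglongrightarrow> \<alpha>"
    proof (rule tendsto_sandwich[OF _ _ lim])
      show "(\<lambda>j. min \<alpha> (1 - 3 / \<gamma> j) + real (M (x j)) / \<Lambda> j) \<longlonglongrightarrow> \<alpha>"
        using tendsto_add[OF lim M0] by simp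
      show "\<forall>\<^sub>F j in sequentially. min \<alpha> (1 - 3 / \<gamma> j) \<le> real (card (P j)) / \<Lambda> j"
      proof (intro always_eventually allI)
        fix j
        show "min \<alpha> (1 - 3 / \<gamma> j) \<le> real (card (P j)) / \<Lambda> j"
          using block(9)[OF xX0, of j] \<Lambda>0[of j]
          by (simp add: P_def I_def xS \<gamma>_def \<Lambda>_def pos_le_divide_eq)
      qed
      show "\<forall>\<^sub>F j in sequentially. real (card (P j)) / \<Lambda> j \<le> min \<alpha> (1 - 3 / \<gamma> j) + real (M (x j)) / \<Lambda> j"
      proof (intro always_eventually allI)
        fix j
        have "real (card (P j)) \<le> min \<alpha> (1 - 3 / \<gamma> j) * \<Lambda> j + real (M (x j))"
          using block(10)[OF xX0, of j] by (simp add: P_def I_def xS \<gamma>_def \<Lambda>_def)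
        then have "real (card (P j)) / \<Lambda> j \<le> (min \<alpha> (1 - 3 / \<gamma> j) * \<Lambda> j + real (M (x j))) / \<Lambda> j"
          using \<Lambda>0[of j] by (intro divide_right_mono) auto
        then show "real (card (P j)) / \<Lambda> j \<le> min \<alpha> (1 - 3 / \<gamma> j) + real (M (x j)) / \<Lambda> j"
          using \<Lambda>0[of j] by (simp add: add_divide_distrib)
      qed
    qed
    then show "(\<lambda>j. real (card (D \<inter> {x j<..x (Suc j)})) / (real (x (Suc j)) - real (x j))) \<longlonglongrightarrow> \<alpha>"
      unfolding I_def[symmetric] DI \<Lambda>x .
  qed

  \<comment> \<open>Negligibility of the remaining sums\<close>
  moreover have "has_density E 0"
    unfolding has_density_def
  proof (rule tendsto_ratio_of_subseq[OF _ xmono ratio])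
    show "mono (\<lambda>n. card (E \<inter> {1..n}))" by (intro monoI card_mono) auto
    \<comment> \<open>The first factor bounds the number of translation points in block j. The
      second, multiplied by sqrt (x_k / x_j), bounds the elements of \<open>B\<close> in
      \<open>{M (x j)<..x k}\<close>; its 3 is 1 from the counting bound plus 2 from ln r \<le> 2
      sqrt r.\<close>
    define v where "v j = 4 * \<Lambda> j / \<gamma> j * (C * (3 + ln (2 * (\<gamma> j)\<^sup>2)))" for j
    have \<gamma>1: "1 \<le> 2 * (\<gamma> j)\<^sup>2" for j using one_le_power[of "\<gamma> j" 2] \<gamma>3[of j] by linarith
    have v0: "v j \<ge> 0" for j
      unfolding v_def using C \<Lambda>0[of j] \<gamma>3[of j] ln_ge_zero[OF \<gamma>1, of j]
      by (intro mult_nonneg_nonneg divide_nonneg_nonneg) auto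
    \<comment> \<open>A sum in \<open>E\<close> either uses b up to \<open>M (x j)\<close> and then
      lies past the end of its block by at most \<open>M (x j)\<close>, or uses b beyond the
      truncation. Only blocks starting before \<open>x k\<close> contribute.\<close>
    have sub: "E \<inter> {1..x k} \<subseteq> (\<Union>j<k. {x (Suc j)<..x (Suc j) + M (x j)}
        \<union> (\<lambda>(a, b). a + b) ` (A (x j) \<times> (B \<inter> {M (x j)<..x k})))" for k
    proof
      fix n assume n: "n \<in> E \<inter> {1..x k}"
      then obtain a b j where ab: "a \<in> A (x j)" "b \<in> B" "n = a + b"
        by (auto simp: E_def \<A>_def set_plus_def)
      have b1: "b \<ge> 1" using ab(2) B by auto
      have aj: "x j < a" "a \<le> x (Suc j)" using ab(1) AI[of j] by (auto simp: I_def)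
      then have "x j < x k" using n ab(3) by auto
      then have jk: "j < k" using xmono by (simp add: strict_mono_less)
      have "n \<in> {x (Suc j)<..x (Suc j) + M (x j)}
        \<union> (\<lambda>(a, b). a + b) ` (A (x j) \<times> (B \<inter> {M (x j)<..x k}))"
      proof (cases "b \<le> M (x j)")
        case True
        then have "n \<in> A (x j) + (B \<inter> {1..M (x j)})"
          unfolding ab(3) using ab b1 by (intro set_plus_intro) auto
        moreover have "n \<notin> P j" using n by (auto simp: E_def D_def)
        ultimately have "n \<notin> I j" by (simp add: P_def)
        then show ?thesis using aj ab(3) True by (auto simp: I_def)
      next
        case False
        then have "(a, b) \<in> A (x j) \<times> (B \<inter> {M (x j)<..x k})" using ab n by auto
        then show ?thesis using ab(3) by force
      qed
      then show "n \<in> (\<Union>j<k. {x (Suc j)<..x (Suc j) + M (x j)}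
        \<union> (\<lambda>(a, b). a + b) ` (A (x j) \<times> (B \<inter> {M (x j)<..x k})))" using jk by blast
    qed
    have finA: "finite (A (x j))" for j using AI[of j] finite_subset by (auto simp: I_def)
    \<comment> \<open>Bounding $\ln r$ by $2 \sqrt r$ separates the variables, so that Stolz--Cesaro applies with
      the denominators $\sqrt{x_k}$.\<close>
    have tail: "real (card (A (x j)) * card (B \<inter> {M (x j)<..x k})) \<le> v j / sqrt (x j) * sqrt (x k)"
      if "j < k" for j k
    proof -
      have "real (M (x j)) \<le> 2 * \<Lambda> j / \<gamma> j" using block(6)[OF xX0] by (simp add: \<Lambda>_def \<gamma>_def)
      also have "\<dots> \<le> \<Lambda> j" using \<gamma>3[of j] \<Lambda>0[of j] by (simp add: field_simps)
      also have "\<dots> \<le> real (x (Suc j))" using \<Lambda>x[of j] by simp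
      also have "\<dots> \<le> real (x k)" using that xmono by (simp add: strict_mono_less_eq)
      finally have Mk: "M (x j) \<le> x k" by simp
      have M1: "M (x j) \<ge> 1" using block(3)[OF xX0] .
      define r where "r = real (x k) / real (x j)"
      have r1: "r \<ge> 1"
        using that xmono xpos[of j] by (simp add: r_def strict_mono_less_eq)
      have s1: "sqrt r \<ge> 1" using r1 by simp
      have "real (x k) / real (M (x j)) \<le> 2 * (\<gamma> j)\<^sup>2 * r"
      proof -
        have "real (x j) * real (x k) \<le> 2 * (\<gamma> j)\<^sup>2 * real (M (x j)) * real (x k)"
          using block(5)[OF xX0, of j] by (intro mult_right_mono) (auto simp: \<gamma>_def)
        then show ?thesis using M1 xpos[of j] by (simp add: r_def field_simps)
      qed
      then have "ln (real (x k) / real (M (x j))) \<le> ln (2 * (\<gamma> j)\<^sup>2 * r)"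
        using M1 xpos[of k] by (intro ln_mono) auto
      also have "\<dots> = ln (2 * (\<gamma> j)\<^sup>2) + ln r" using \<gamma>1[of j] r1 by (intro ln_mult_pos) auto
      also have "ln r = 2 * ln (sqrt r)" using r1 by (simp add: ln_sqrt)
      also have "\<dots> \<le> 2 * sqrt r" using ln_bound[of "sqrt r"] s1 by simp
      finally have "1 + ln (real (x k) / real (M (x j))) \<le> (1 + ln (2 * (\<gamma> j)\<^sup>2)) * 1 + 2 * sqrt r"
        by simp
      also have "\<dots> \<le> (1 + ln (2 * (\<gamma> j)\<^sup>2)) * sqrt r + 2 * sqrt r"
        using s1 ln_ge_zero[OF \<gamma>1, of j] by (intro add_right_mono mult_left_mono) auto
      also have "\<dots> = (3 + ln (2 * (\<gamma> j)\<^sup>2)) * sqrt r" by (simp add: algebra_simps)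
      finally have "C * (1 + ln (real (x k) / real (M (x j)))) \<le> C * ((3 + ln (2 * (\<gamma> j)\<^sup>2)) * sqrt r)"
        using C by (rule mult_left_mono)
      moreover have "real (card (B \<inter> {M (x j)<..x k})) \<le> C * (1 + ln (real (x k) / real (M (x j))))"
        using M1 Mk by (intro cnt) auto
      ultimately have "real (card (B \<inter> {M (x j)<..x k})) \<le> C * ((3 + ln (2 * (\<gamma> j)\<^sup>2)) * sqrt r)"
        by linarith
      moreover have "real (card (A (x j))) \<le> 4 * \<Lambda> j / \<gamma> j"
        using block(8)[OF xX0] by (simp add: \<Lambda>_def \<gamma>_def)
      ultimately have "real (card (A (x j))) * real (card (B \<inter> {M (x j)<..x k}))
          \<le> 4 * \<Lambda> j / \<gamma> j * (C * ((3 + ln (2 * (\<gamma> j)\<^sup>2)) * sqrt r))"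
        using \<Lambda>0[of j] \<gamma>3[of j] by (intro mult_mono) auto
      also have "\<dots> = v j / sqrt (x j) * sqrt (x k)"
        by (simp add: v_def r_def real_sqrt_divide)
      finally show ?thesis by simp
    qed
    have bound: "real (card (E \<inter> {1..x k}))
        \<le> (\<Sum>j<k. real (M (x j))) + (\<Sum>j<k. v j / sqrt (x j)) * sqrt (x k)" for k
    proof -
      let ?S = "\<lambda>j. {x (Suc j)<..x (Suc j) + M (x j)}"
      let ?T = "\<lambda>j. (\<lambda>(a, b). a + b) ` (A (x j) \<times> (B \<inter> {M (x j)<..x k}))"
      have "card (E \<inter> {1..x k}) \<le> card (\<Union>j<k. ?S j \<union> ?T j)"
        by (rule card_mono[OF _ sub]) (use finA in auto)
      also have "\<dots> \<le> (\<Sum>j<k. card (?S j \<union> ?T j))" by (rule card_UN_le) simp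
      also have "\<dots> \<le> (\<Sum>j<k. M (x j) + card (A (x j)) * card (B \<inter> {M (x j)<..x k}))"
      proof (rule sum_mono)
        fix j
        have "card (?T j) \<le> card (A (x j) \<times> (B \<inter> {M (x j)<..x k}))"
          by (rule card_image_le) (use finA in auto)
        then show "card (?S j \<union> ?T j) \<le> M (x j) + card (A (x j)) * card (B \<inter> {M (x j)<..x k})"
          using card_Un_le[of "?S j" "?T j"] by (simp add: card_cartesian_product)
      qed
      finally have "real (card (E \<inter> {1..x k}))
          \<le> real (\<Sum>j<k. M (x j) + card (A (x j)) * card (B \<inter> {M (x j)<..x k}))"
        by (simp only: of_nat_le_iff)
      also have "\<dots> = (\<Sum>j<k. real (M (x j)) + real (card (A (x j)) * card (B \<inter> {M (x j)<..x k})))"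
        by simp
      also have "\<dots> \<le> (\<Sum>j<k. real (M (x j)) + v j / sqrt (x j) * sqrt (x k))"
        by (intro sum_mono add_left_mono tail) auto
      finally show ?thesis by (simp add: sum.distrib sum_distrib_right)
    qed
    have lim1: "(\<lambda>k. (\<Sum>j<k. real (M (x j))) / real (x k)) \<longlonglongrightarrow> 0"
      by (rule stolz_cesaro[OF rxmono rxtop]) (use M0 in \<open>simp only: \<Lambda>x\<close>)
    have lim2: "(\<lambda>k. (\<Sum>j<k. v j / sqrt (x j)) / sqrt (x k)) \<longlonglongrightarrow> 0"
    proof (rule stolz_cesaro)
      show "strict_mono (\<lambda>k. sqrt (x k))" using xmono by (simp add: strict_mono_def)
      show "filterlim (\<lambda>k. sqrt (x k)) at_top sequentially"
        by (rule filterlim_compose[OF sqrt_at_top rxtop])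
      have "(\<lambda>n. (3 + ln (2 * (real n)\<^sup>2)) / real n) \<longlonglongrightarrow> 0" by real_asymp
      from tendsto_mult_right_zero[OF \<gamma>lim[OF this], of "12 * C"]
      have w: "(\<lambda>j. 12 * C * ((3 + ln (2 * (\<gamma> j)\<^sup>2)) / \<gamma> j)) \<longlonglongrightarrow> 0" .
      show "(\<lambda>j. v j / sqrt (x j) / (sqrt (x (Suc j)) - sqrt (x j))) \<longlonglongrightarrow> 0"
      proof (rule tendsto_sandwich[OF _ _ tendsto_const w])
        have d: "sqrt (x (Suc j)) - sqrt (x j) > 0" for j
          using strict_monoD[OF xmono, of j "Suc j"] by simp
        show "\<forall>\<^sub>F j in sequentially. 0 \<le> v j / sqrt (x j) / (sqrt (x (Suc j)) - sqrt (x j))"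
          using v0 d by (simp add: less_imp_le)
        show "\<forall>\<^sub>F j in sequentially. v j / sqrt (x j) / (sqrt (x (Suc j)) - sqrt (x j))
            \<le> 12 * C * ((3 + ln (2 * (\<gamma> j)\<^sup>2)) / \<gamma> j)"
        proof (intro always_eventually allI)
          fix j
          \<comment> \<open>Since \<open>\<Lambda> j\<close> = (s' - s)(s' + s) and s' is at most 2
            s, the increment s' - s is at least \<open>\<Lambda> j\<close> / (3 s). The block length
            then cancels against \<open>v j\<close>, and 12 = 3 * 4.\<close>
          define s s' where "s = sqrt (x j)" and "s' = sqrt (x (Suc j))"
          have s0: "s > 0" using xpos[of j] by (simp add: s_def)
          have "\<Lambda> j \<le> real (x j) / \<gamma> j" using block(4)[OF xX0] by (simp add: \<Lambda>_def \<gamma>_def)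
          also have "\<dots> \<le> real (x j)" using \<gamma>3[of j] xpos[of j] by (simp add: field_simps)
          finally have "real (x (Suc j)) \<le> 4 * real (x j)" using \<Lambda>x[of j] by simp
          then have "s' \<le> sqrt (4 * real (x j))" unfolding s'_def by (rule real_sqrt_le_mono)
          then have s2: "s' \<le> 2 * s" by (simp add: s_def real_sqrt_mult)
          have "\<Lambda> j = s'\<^sup>2 - s\<^sup>2" using \<Lambda>x[of j] by (simp add: s_def s'_def)
          also have "\<dots> = (s' - s) * (s' + s)" by (simp add: power2_eq_square algebra_simps)
          also have "\<dots> \<le> (s' - s) * (3 * s)"
            using s2 d[of j] by (intro mult_left_mono) (auto simp: s_def s'_def)
          finally have "\<Lambda> j \<le> 3 * (s * (s' - s))" by (simp add: algebra_simps)
          then have "1 / (s * (s' - s)) \<le> 3 / \<Lambda> j"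
            using s0 d[of j] \<Lambda>0[of j] by (simp add: s_def s'_def field_simps)
          then have "v j * (1 / (s * (s' - s))) \<le> v j * (3 / \<Lambda> j)"
            using v0 by (rule mult_left_mono)
          also have "\<dots> = 12 * C * ((3 + ln (2 * (\<gamma> j)\<^sup>2)) / \<gamma> j)"
            using \<Lambda>0[of j] by (simp add: v_def)
          finally show "v j / sqrt (x j) / (sqrt (x (Suc j)) - sqrt (x j))
              \<le> 12 * C * ((3 + ln (2 * (\<gamma> j)\<^sup>2)) / \<gamma> j)"
            by (simp add: s_def s'_def)
        qed
      qed
    qed
    show "(\<lambda>k. real (card (E \<inter> {1..x k})) / real (x k)) \<longlonglongrightarrow> 0"
    proof (rule tendsto_sandwich[OF _ _ tendsto_const])
      show "(\<lambda>k. (\<Sum>j<k. real (M (x j))) / real (x k) + (\<Sum>j<k. v j / sqrt (x j)) / sqrt (x k)) \<longlonglongrightarrow> 0"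
        using tendsto_add[OF lim1 lim2] by simp
      show "\<forall>\<^sub>F k in sequentially. real (card (E \<inter> {1..x k})) / real (x k)
          \<le> (\<Sum>j<k. real (M (x j))) / real (x k) + (\<Sum>j<k. v j / sqrt (x j)) / sqrt (x k)"
      proof (intro always_eventually allI)
        fix k
        have "real (card (E \<inter> {1..x k})) / real (x k)
            \<le> ((\<Sum>j<k. real (M (x j))) + (\<Sum>j<k. v j / sqrt (x j)) * sqrt (x k)) / real (x k)"
          using bound[of k] by (intro divide_right_mono) auto
        also have "\<dots> = (\<Sum>j<k. real (M (x j))) / real (x k)
            + (\<Sum>j<k. v j / sqrt (x j)) * (sqrt (x k) / real (x k))"
          by (simp add: add_divide_distrib)
        also have "sqrt (x k) / real (x k) = 1 / sqrt (x k)"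
          using xpos[of k] by (simp add: sqrt_divide_self_eq inverse_eq_divide)
        finally show "real (card (E \<inter> {1..x k})) / real (x k)
            \<le> (\<Sum>j<k. real (M (x j))) / real (x k) + (\<Sum>j<k. v j / sqrt (x j)) / sqrt (x k)"
          by simp
      qed
    qed simp
  qed

  ultimately have dens: "has_density \<A> 0" "has_density D \<alpha>" "has_density E 0" by auto
  \<comment> \<open>The sumset is the disjoint union of \<open>D\<close> and \<open>E\<close>, so
    the two densities add up.\<close>
  have "D \<subseteq> \<A> + B" by (auto simp: D_def P_def \<A>_def set_plus_def)
  then have "(\<A> + B) \<inter> {1..n} = (D \<inter> {1..n}) \<union> (E \<inter> {1..n})" for n
    by (auto simp: E_def)
  moreover have "card ((D \<inter> {1..n}) \<union> (E \<inter> {1..n})) = card (D \<inter> {1..n}) + card (E \<inter> {1..n})" for n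
    by (rule card_Un_disjoint) (auto simp: E_def)
  ultimately have "has_density (\<A> + B) \<alpha>"
    using tendsto_add[OF dens(2,3)[unfolded has_density_def]]
    by (simp add: has_density_def add_divide_distrib)
  moreover have "\<A> \<subseteq> {1..}" using AI by (fastforce simp: \<A>_def I_def)
  ultimately show ?thesis using dens(1) by blast
qed

theorem corollary1p7:
  fixes q :: nat and B :: "nat \<Rightarrow> nat set"
  assumes "q \<ge> 1"
    and "\<And>i. i \<in> {1..q} \<Longrightarrow> B i \<subseteq> {1..}"
    and "\<And>i. i \<in> {1..q} \<Longrightarrow> B i \<noteq> {}"
    and "infinite (\<Union>i\<in>{1..q}. B i)"
    and "\<And>i. i \<in> {1..q} \<Longrightarrow> infinite (B i) \<Longrightarrow>
           liminf (\<lambda>n. ereal (real (enumerate (B i) (Suc n)) / real (enumerate (B i) n))) > 1"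
  shows "\<forall>\<alpha>::real. 0 \<le> \<alpha> \<and> \<alpha> \<le> 1 \<longrightarrow>
           (\<exists>A \<subseteq> {1..}. has_density A 0 \<and> has_density (A + (\<Union>i\<in>{1..q}. B i)) \<alpha>)"
proof (intro allI impI)
  fix \<alpha> :: real assume \<alpha>: "0 \<le> \<alpha> \<and> \<alpha> \<le> 1"
  \<comment> \<open>The ratio condition on the individual sets is traded for one counting bound on
    their union. \<open>enumerate\<close> counts from 0, an index shift that leaves the liminf
    unchanged.\<close>
  obtain C where C: "C \<ge> 0" "\<And>x y. 0 < x \<Longrightarrow> x \<le> y \<Longrightarrow>
      real (card ((\<Union>i\<in>{1..q}. B i) \<inter> {x<..y})) \<le> C * (1 + ln (real y / real x))"
    using lacunary_Union_count[of "{1..q}" B] assms(5) by auto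
  have "(\<Union>i\<in>{1..q}. B i) \<subseteq> {1..}" using assms(2) by blast
  then show "\<exists>A\<subseteq>{1..}. has_density A 0 \<and> has_density (A + (\<Union>i\<in>{1..q}. B i)) \<alpha>"
    using sumset_density[OF _ assms(4) C(2) C(1)] \<alpha> by simp
qed

end
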